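(* Let $\sigma_l(x):=\frac{1}{1+e^{-x}}$ be the logistic function and $r\in\mathbb{N}$. For each abstract modulus of smoothness $\omega$ satisfying $\lim_{\delta\to0+}\omega(\delta)/\delta=\infty$ there exists $f_\omega\in C[0,1]$ such that $$\omega_r(f_\omega,\delta)=O(\omega(\delta^r))\ (\delta\to0+)\quad\text{and}\quad E(\Phi_{n,\sigma_l},f_\omega)\ne o\Big(\omega\Big(\frac{1}{(n[1+\log_2(n)])^r}\Big)\Big)\ (n\to\infty).$$
   Context: $\mathbb{N}=\{1,2,\dots\}$. For $\sigma:\mathbb{R}\to\mathbb{R}$, $\Phi_{n,\sigma}:=\{g:[0,1]\to\mathbb{R}: g(x)=\sum_{k=1}^n a_k\sigma(b_kx+c_k),\ a_k,b_k,c_k\in\mathbb{R}\}$ and, for $f\in C[0,1]$, $E(\Phi_{n,\sigma},f):=\inf\{\sup_{x\in[0,1]}|f(x)-g(x)|:g\in\Phi_{n,\sigma}\}$. With $\Delta_h^rf(x):=\sum_{j=0}^r(-1)^{r-j}\binom rj f(x+jh)$, $\omega_r(f,\delta):=\sup\{|\Delta_h^rf(x)|:x\in[0,1-rh],\ 0<h\le\delta\}$ (only step sizes with $rh\le1$ contribute). An abstract modulus of smoothness is a continuous, increasing (non-decreasing) function $\omega$ on $[0,\infty)$ with $0=\omega(0)<\omega(\delta_1)\le\omega(\delta_1+\delta_2)\le\omega(\delta_1)+\omega(\delta_2)$ for all $\delta_1,\delta_2>0$. *)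

theory Defs
  imports "HOL-Analysis.Analysis" "HOL-Library.Landau_Symbols"
begin

text \<open>
  Functions on \<open>[0,1]\<close> are represented by total functions of which only the values on
  \<open>{0..1}\<close> matter; likewise an abstract modulus of smoothness is a total function of which
  only the values on \<open>{0..}\<close> matter.
\<close>

definition logistic :: "real \<Rightarrow> real" where
  "logistic x = 1 / (1 + exp (- x))"

definition networks :: "nat \<Rightarrow> (real \<Rightarrow> real) \<Rightarrow> (real \<Rightarrow> real) set" where
  "networks n \<sigma> =
     {g. \<exists>a b c :: nat \<Rightarrow> real. \<forall>x\<in>{0..1}. g x = (\<Sum>k=1..n. a k * \<sigma> (b k * x + c k))}"

text \<open>
  The supremum is taken in the reals, so it is the intended one only when \<open>f - g\<close> is bounded
  on \<open>{0..1}\<close>, e.g. for \<open>f\<close> continuous on \<open>{0..1}\<close> and \<open>\<Phi> = networks n \<sigma>\<close> with \<open>\<sigma>\<close> bounded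
  or continuous.
\<close>
definition best_approx_error :: "(real \<Rightarrow> real) set \<Rightarrow> (real \<Rightarrow> real) \<Rightarrow> real" where
  "best_approx_error \<Phi> f = (INF g\<in>\<Phi>. SUP x\<in>{0..1}. \<bar>f x - g x\<bar>)"

definition fwd_diff :: "nat \<Rightarrow> real \<Rightarrow> (real \<Rightarrow> real) \<Rightarrow> real \<Rightarrow> real" where
  "fwd_diff r h f x = (\<Sum>j=0..r. (-1) ^ (r - j) * real (r choose j) * f (x + real j * h))"

text \<open>
  Step sizes with \<open>r * h > 1\<close> contribute nothing, since then \<open>{0..1 - r * h}\<close> is empty. For
  \<open>r \<ge> 1\<close>, \<open>\<delta> > 0\<close> and \<open>f\<close> bounded on \<open>{0..1}\<close> the set is nonempty and bounded, so that the
  real supremum is the intended one.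
\<close>
definition smoothness_modulus :: "nat \<Rightarrow> (real \<Rightarrow> real) \<Rightarrow> real \<Rightarrow> real" where
  "smoothness_modulus r f \<delta> =
     Sup {\<bar>fwd_diff r h f x\<bar> | x h. x \<in> {0..1 - real r * h} \<and> 0 < h \<and> h \<le> \<delta>}"

definition abstract_modulus :: "(real \<Rightarrow> real) \<Rightarrow> bool" where
  "abstract_modulus \<omega> \<longleftrightarrow>
     continuous_on {0..} \<omega> \<and> mono_on {0..} \<omega> \<and> \<omega> 0 = 0 \<and>
     (\<forall>\<delta>\<^sub>1>0. \<forall>\<delta>\<^sub>2>0. 0 < \<omega> \<delta>\<^sub>1 \<and> \<omega> \<delta>\<^sub>1 \<le> \<omega> (\<delta>\<^sub>1 + \<delta>\<^sub>2) \<and> \<omega> (\<delta>\<^sub>1 + \<delta>\<^sub>2) \<le> \<omega> \<delta>\<^sub>1 + \<omega> \<delta>\<^sub>2)"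

end

theory Submission
  imports Defs
begin

text \<open>
  The function is a gliding hump \<open>f = (\<Sum>k. A\<^sub>k * w\<^sub>k)\<close>. The hump \<open>w\<^sub>k\<close> consists of \<open>M\<^sub>k\<close>
  adjacent bumps of height \<open>1\<close> and width \<open>1 / M\<^sub>k\<close>, each carrying a sign that is still free, and
  \<open>A\<^sub>k = \<omega> (1 / M\<^sub>k ^ r)\<close>. With \<open>n = 2 ^ L\<close> and \<open>M = 256 * n * (1 + log\<^sub>2 n)\<close> the height is
  comparable to the rate in the theorem, because \<open>\<omega>\<close> is subadditive.

  Lower bound. Whatever the partial sum of the preceding humps is, the signs of the next one
  can be chosen such that no network with \<open>n\<close> neurons comes within \<open>2 / 3 * A\<^sub>k\<close> of the new partial
  sum at all bump centres (\<open>networks_miss_signed_wave\<close>). The later humps add up to at most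
  \<open>A\<^sub>k / 3\<close>, so that the error of \<open>f\<close> is at least \<open>A\<^sub>k / 3\<close>.

  The choice of signs rests on a dimension count (\<open>rational_map_misses_cube_vertex\<close>). The values
  of a logistic network at \<open>M\<close> equidistant points are rational functions of the \<open>3 * n\<close>
  parameters \<open>a\<^sub>k\<close>, \<open>exp (- b\<^sub>k / M)\<close>, \<open>exp (- c\<^sub>k - b\<^sub>k / (2 * M))\<close>, with degrees polynomial
  in \<open>M\<close>. Suppose that every sign vector \<open>t\<close> were approximated up to \<open>2 / 3\<close> by a vector
  \<open>z\<^sub>t\<close> of such values. The polynomials \<open>P\<^sub>s(z) = (\<Prod>j<M. (1 + s\<^sub>j * z\<^sub>j) ^ M)\<close> almost separate
  these vectors: a disagreement \<open>s\<^sub>j \<noteq> t\<^sub>j\<close> at least halves the modulus of \<open>1 + t\<^sub>j * z\<^sub>j\<close>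
  at \<open>z = z\<^sub>t\<close>, and the power \<open>M\<close> turns this into \<open>\<bar>P\<^sub>s(z\<^sub>t)\<bar> \<le> \<bar>P\<^sub>t(z\<^sub>t)\<bar> / 2 ^ M\<close> for
  \<open>s \<noteq> t\<close>. So the square matrix \<open>P\<^sub>s(z\<^sub>t)\<close> of size \<open>2 ^ M\<close> is diagonally dominant, and the \<open>P\<^sub>s\<close>
  are linearly independent (\<open>card_le_of_dominant_witnesses\<close>). But after the denominators are
  cleared they lie in a space of polynomials in \<open>3 * n\<close> variables of dimension at most
  \<open>M ^ O(n)\<close>, which is less than \<open>2 ^ M\<close> as soon as \<open>M\<close> is a large multiple of
  \<open>n * (1 + log\<^sub>2 n)\<close>.

  Upper bound. The bumps are bounded by \<open>1\<close> and \<open>r\<close> times differentiable, whence the \<open>r\<close>-th difference of \<open>w\<^sub>k\<close> with step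
  \<open>h\<close> is bounded by \<open>2 ^ r\<close> and by \<open>C * (M\<^sub>k * h) ^ r\<close>. The \<open>M\<^sub>k\<close> are so sparse that
  \<open>A\<^sub>k\<close> decays geometrically and, since \<open>\<omega> \<delta> / \<delta>\<close> tends to infinity, \<open>A\<^sub>k * M\<^sub>k ^ r\<close> grows
  geometrically. Hence the sum over all \<open>k\<close> is dominated by the terms with \<open>M\<^sub>k\<close> next to
  \<open>1 / h\<close>, and those are of order \<open>\<omega> (h ^ r)\<close> (\<open>fwd_diff_lacunary_series\<close>).
\<close>

section \<open>Counting functions by a dominant diagonal\<close>

lemma exists_nontrivial_relation:
  fixes c :: "'s \<Rightarrow> 'e \<Rightarrow> real"
  assumes "finite E" "finite S" "card E < card S"
  shows "\<exists>l. (\<exists>s\<in>S. l s \<noteq> 0) \<and> (\<forall>e\<in>E. (\<Sum>s\<in>S. l s * c s e) = 0)"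
  using assms
proof (induction E arbitrary: S c rule: finite_induct)
  case empty
  then have "S \<noteq> {}" by auto
  then show ?case by (intro exI[of _ "\<lambda>_. 1"]) auto
next
  case (insert e E)
  show ?case
  proof (cases "\<forall>s\<in>S. c s e = 0")
    case True
    from insert.IH[of S c] insert.prems insert.hyps obtain l
      where "\<exists>s\<in>S. l s \<noteq> 0" "\<forall>e\<in>E. (\<Sum>s\<in>S. l s * c s e) = 0" by auto
    with True show ?thesis by (intro exI[of _ l]) auto
  next
    case False
    then obtain s0 where s0: "s0 \<in> S" "c s0 e \<noteq> 0" by blast
    define S' where "S' = S - {s0}"
    have "card E < card S'" "finite S'"
      using insert.prems insert.hyps s0 by (auto simp: S'_def)
    then obtain l where l: "\<exists>s\<in>S'. l s \<noteq> 0"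
      and rel: "\<forall>e'\<in>E. (\<Sum>s\<in>S'. l s * (c s e' - c s e / c s0 e * c s0 e')) = 0"
      using insert.IH[of S' "\<lambda>s e'. c s e' - c s e / c s0 e * c s0 e'"] by blast
    define m where "m = (\<lambda>s. if s = s0 then - (\<Sum>s\<in>S'. l s * c s e) / c s0 e else l s)"
    have S: "(\<Sum>s\<in>S. m s * d s) = (\<Sum>s\<in>S'. l s * d s) - (\<Sum>s\<in>S'. l s * c s e) / c s0 e * d s0" for d
    proof -
      have "(\<Sum>s\<in>S. m s * d s) = m s0 * d s0 + (\<Sum>s\<in>S'. m s * d s)"
        unfolding S'_def using s0 insert.prems(1) by (subst sum.remove[of _ s0]) auto
      also have "(\<Sum>s\<in>S'. m s * d s) = (\<Sum>s\<in>S'. l s * d s)"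
        by (intro sum.cong) (auto simp: m_def S'_def)
      finally show ?thesis by (simp add: m_def)
    qed
    have "(\<Sum>s\<in>S. m s * c s e') = 0" if "e' \<in> insert e E" for e'
    proof (cases "e' = e")
      case True
      then show ?thesis using s0 by (simp add: S)
    next
      case False
      then have "(\<Sum>s\<in>S'. l s * (c s e' - c s e / c s0 e * c s0 e')) = 0"
        using rel that by auto
      moreover have "(\<Sum>s\<in>S'. l s * (c s e' - c s e / c s0 e * c s0 e'))
          = (\<Sum>s\<in>S'. l s * c s e') - (\<Sum>s\<in>S'. l s * c s e) / c s0 e * c s0 e'"
        by (simp add: algebra_simps sum_subtractf sum_distrib_left sum_divide_distrib)
      ultimately show ?thesis by (simp add: S)
    qed
    moreover have "\<exists>s\<in>S. m s \<noteq> 0" using l by (auto simp: m_def S'_def)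
    ultimately show ?thesis by (intro exI[of _ m]) auto
  qed
qed

text \<open>
  The dominance hypothesis makes the functions \<open>P s\<close> linearly independent, while all of them lie
  in the span of the functions \<open>m e\<close>: in a linear relation, evaluate at the witness of the
  function with the largest coefficient.
\<close>
lemma card_le_of_dominant_witnesses:
  fixes P :: "'s \<Rightarrow> 'p \<Rightarrow> real"
  assumes fin: "finite S" "finite E"
    and P: "\<And>s x. s \<in> S \<Longrightarrow> P s x = (\<Sum>e\<in>E. c s e * m e x)"
    and dom: "\<And>s. s \<in> S \<Longrightarrow> \<exists>x. (\<Sum>t\<in>S - {s}. \<bar>P t x\<bar>) < \<bar>P s x\<bar>"
  shows "card S \<le> card E"
proof (rule ccontr)
  assume "\<not> card S \<le> card E"
  then obtain l where l: "\<exists>s\<in>S. l s \<noteq> 0" and rel: "\<forall>e\<in>E. (\<Sum>s\<in>S. l s * c s e) = 0"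
    using exists_nontrivial_relation[OF fin(2,1)] by (metis not_le)
  have "S \<noteq> {}" using l by auto
  then obtain s where s: "s \<in> S" "\<bar>l s\<bar> = Max ((\<lambda>t. \<bar>l t\<bar>) ` S)"
    using Max_in[of "(\<lambda>t. \<bar>l t\<bar>) ` S"] fin(1) \<open>S \<noteq> {}\<close> by (metis empty_is_image finite_imageI imageE)
  have max: "\<bar>l t\<bar> \<le> \<bar>l s\<bar>" if "t \<in> S" for t
    using that fin(1) unfolding s(2) by simp
  have pos: "\<bar>l s\<bar> > 0" using l max by fastforce
  obtain x where x: "(\<Sum>t\<in>S - {s}. \<bar>P t x\<bar>) < \<bar>P s x\<bar>" using dom s by blast
  have "(\<Sum>t\<in>S. l t * P t x) = (\<Sum>t\<in>S. \<Sum>e\<in>E. (l t * c t e) * m e x)"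
    by (intro sum.cong refl) (simp add: P sum_distrib_left mult.assoc)
  also have "\<dots> = (\<Sum>e\<in>E. (\<Sum>t\<in>S. l t * c t e) * m e x)"
    by (subst sum.swap) (simp add: sum_distrib_right)
  also have "\<dots> = 0" using rel by simp
  finally have "l s * P s x + (\<Sum>t\<in>S - {s}. l t * P t x) = 0"
    using sum.remove[OF fin(1) s(1), of "\<lambda>t. l t * P t x"] by simp
  then have "\<bar>l s\<bar> * \<bar>P s x\<bar> = \<bar>\<Sum>t\<in>S - {s}. l t * P t x\<bar>"
    by (simp add: abs_mult [symmetric])
  also have "\<dots> \<le> (\<Sum>t\<in>S - {s}. \<bar>l t\<bar> * \<bar>P t x\<bar>)"
    by (rule order_trans[OF sum_abs]) (simp add: abs_mult)
  also have "\<dots> \<le> (\<Sum>t\<in>S - {s}. \<bar>l s\<bar> * \<bar>P t x\<bar>)"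
    by (intro sum_mono mult_right_mono) (use max in auto)
  also have "\<dots> = \<bar>l s\<bar> * (\<Sum>t\<in>S - {s}. \<bar>P t x\<bar>)" by (simp add: sum_distrib_left)
  also have "\<dots> < \<bar>l s\<bar> * \<bar>P s x\<bar>" using x pos by simp
  finally show False by simp
qed

section \<open>Polynomials of bounded degree in each variable\<close>

text \<open>
  The polynomials in the variables indexed by \<open>I\<close> of degree at most \<open>d\<close> in each of them.
  Bounding the degrees separately rather than in total makes the number \<open>(d + 1) ^ card I\<close> of
  monomials and the degrees of products immediate.
\<close>
definition box_poly :: "'i set \<Rightarrow> nat \<Rightarrow> (('i \<Rightarrow> real) \<Rightarrow> real) \<Rightarrow> bool" where
  "box_poly I d f \<longleftrightarrow>
     (\<exists>c. \<forall>x. f x = (\<Sum>e\<in>I \<rightarrow>\<^sub>E {..d}. c e * (\<Prod>i\<in>I. x i ^ e i)))"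

lemma box_poly_monomial:
  assumes "finite I" "\<And>i. i \<in> I \<Longrightarrow> e i \<le> d"
  shows "box_poly I d (\<lambda>x. a * (\<Prod>i\<in>I. x i ^ e i))"
proof -
  let ?e = "restrict e I"
  have e: "?e \<in> I \<rightarrow>\<^sub>E {..d}" using assms by auto
  have fin: "finite (I \<rightarrow>\<^sub>E {..d})" using assms by (intro finite_PiE) auto
  have "(\<Sum>e'\<in>I \<rightarrow>\<^sub>E {..d}. (if e' = ?e then a else 0) * (\<Prod>i\<in>I. x i ^ e' i))
        = a * (\<Prod>i\<in>I. x i ^ e i)" for x
  proof -
    have "(\<Sum>e'\<in>I \<rightarrow>\<^sub>E {..d}. (if e' = ?e then a else 0) * (\<Prod>i\<in>I. x i ^ e' i))
        = (\<Sum>e'\<in>I \<rightarrow>\<^sub>E {..d}. if e' = ?e then a * (\<Prod>i\<in>I. x i ^ e' i) else 0)"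
      by (intro sum.cong) auto
    also have "\<dots> = a * (\<Prod>i\<in>I. x i ^ ?e i)" using e fin by (simp add: sum.delta)
    finally show ?thesis by simp
  qed
  then show ?thesis unfolding box_poly_def
    by (intro exI[of _ "\<lambda>e'. if e' = ?e then a else 0"]) simp
qed

lemma box_poly_sum:
  assumes "\<And>a. a \<in> A \<Longrightarrow> box_poly I d (f a)"
  shows "box_poly I d (\<lambda>x. \<Sum>a\<in>A. f a x)"
proof -
  obtain c where c: "\<And>a x. a \<in> A \<Longrightarrow> f a x = (\<Sum>e\<in>I \<rightarrow>\<^sub>E {..d}. c a e * (\<Prod>i\<in>I. x i ^ e i))"
    using assms unfolding box_poly_def by metis
  have "(\<Sum>a\<in>A. f a x) = (\<Sum>e\<in>I \<rightarrow>\<^sub>E {..d}. (\<Sum>a\<in>A. c a e) * (\<Prod>i\<in>I. x i ^ e i))" for x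
    by (simp add: c sum_distrib_right, subst sum.swap, simp)
  then show ?thesis unfolding box_poly_def by (intro exI[of _ "\<lambda>e. \<Sum>a\<in>A. c a e"]) simp
qed

lemma box_poly_mult:
  assumes I: "finite I" and "box_poly I d f" "box_poly I d' g"
  shows "box_poly I (d + d') (\<lambda>x. f x * g x)"
proof -
  from assms obtain c c' where
    f: "\<And>x. f x = (\<Sum>e\<in>I \<rightarrow>\<^sub>E {..d}. c e * (\<Prod>i\<in>I. x i ^ e i))" and
    g: "\<And>x. g x = (\<Sum>e\<in>I \<rightarrow>\<^sub>E {..d'}. c' e * (\<Prod>i\<in>I. x i ^ e i))"
    unfolding box_poly_def by blast
  have "(\<lambda>x. f x * g x) = (\<lambda>x. \<Sum>e\<in>I \<rightarrow>\<^sub>E {..d}. \<Sum>e'\<in>I \<rightarrow>\<^sub>E {..d'}.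
          (c e * c' e') * (\<Prod>i\<in>I. x i ^ (e i + e' i)))"
    by (simp add: f g sum_product power_add prod.distrib) (simp add: algebra_simps)
  moreover have "box_poly I (d + d') \<dots>"
    by (intro box_poly_sum box_poly_monomial I) (auto simp: PiE_iff intro!: add_mono)
  ultimately show ?thesis by metis
qed

lemma box_poly_const: "finite I \<Longrightarrow> box_poly I d (\<lambda>x. a)"
  using box_poly_monomial[of I "\<lambda>_. 0" d a] by simp

lemma box_poly_mono:
  assumes "finite I" "box_poly I d f" "d \<le> d'"
  shows "box_poly I d' f"
  using box_poly_mult[OF assms(1,2) box_poly_const[OF assms(1), of "d' - d" 1]] assms(3) by simp

lemma box_poly_add:
  assumes "box_poly I d f" "box_poly I d g"
  shows "box_poly I d (\<lambda>x. f x + g x)"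
  using box_poly_sum[of "{True, False}" I d "\<lambda>b. if b then f else g"] assms by simp

lemma box_poly_var:
  assumes "finite I" "i \<in> I"
  shows "box_poly I 1 (\<lambda>x. x i)"
proof -
  have "(\<Prod>j\<in>I. x j ^ (if j = i then 1 else 0)) = x i" for x :: "'a \<Rightarrow> real"
  proof -
    have "(\<Prod>j\<in>I. x j ^ (if j = i then 1 else 0)) = (\<Prod>j\<in>I. if j = i then x j else 1)"
      by (intro prod.cong) auto
    then show ?thesis using assms by (simp add: prod.delta)
  qed
  then show ?thesis
    using box_poly_monomial[of I "\<lambda>j. if j = i then 1 else 0" 1 1] assms by simp
qed

lemma box_poly_prod:
  assumes I: "finite I" and "finite A" "\<And>a. a \<in> A \<Longrightarrow> box_poly I d (f a)"
  shows "box_poly I (card A * d) (\<lambda>x. \<Prod>a\<in>A. f a x)"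
  using assms(2,3)
proof (induction A rule: finite_induct)
  case empty
  show ?case using box_poly_const[OF I] by simp
next
  case (insert a A)
  show ?case using box_poly_mult[OF I, of d "f a" "card A * d"] insert by simp
qed

lemma box_poly_power:
  assumes I: "finite I" and "box_poly I d f"
  shows "box_poly I (m * d) (\<lambda>x. f x ^ m)"
  using box_poly_prod[OF I, of "{..<m}" d "\<lambda>_. f"] assms by simp

section \<open>Sign vectors out of reach of logistic networks\<close>

text \<open>
  If every vertex of the cube were approximated up to \<open>2 / 3\<close> by the rational map \<open>p / q\<close>, then
  the polynomials \<open>P s = (\<Prod>j<M. (q j + s j * p j) ^ M)\<close> would be linearly independent, one for
  each of the \<open>2 ^ M\<close> vertices, by their values at the approximating parameters.
\<close>
lemma rational_map_misses_cube_vertex: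
  fixes p q :: "nat \<Rightarrow> ('i \<Rightarrow> real) \<Rightarrow> real"
  assumes I: "finite I"
    and p: "\<And>j. j < M \<Longrightarrow> box_poly I d (p j)"
    and q: "\<And>j. j < M \<Longrightarrow> box_poly I d (q j)"
    and small: "(M * (M * d) + 1) ^ card I < 2 ^ M"
  shows "\<exists>t \<in> {..<M} \<rightarrow>\<^sub>E {- 1, 1}. \<forall>x. (\<forall>j<M. q j x \<noteq> 0) \<longrightarrow> (\<exists>j<M. 2 / 3 < \<bar>p j x / q j x - t j\<bar>)"
proof (rule ccontr)
  define T :: "(nat \<Rightarrow> real) set" where "T = {..<M} \<rightarrow>\<^sub>E {- 1, 1}"
  define D where "D = M * (M * d)"
  define E where "E = (I \<rightarrow>\<^sub>E {..D})"
  define P where "P = (\<lambda>s x. \<Prod>j<M. (q j x + s j * p j x) ^ M)"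
  have fin: "finite T" "finite E" unfolding T_def E_def using I by (auto intro!: finite_PiE)
  have cardT: "card T = 2 ^ M" unfolding T_def by (simp add: card_PiE numeral_2_eq_2)
  assume "\<not> ?thesis"
  then have close: "\<exists>x. (\<forall>j<M. q j x \<noteq> 0) \<and> (\<forall>j<M. \<bar>p j x / q j x - t j\<bar> \<le> 2 / 3)" if "t \<in> T" for t
    using that unfolding T_def by (meson not_le)
  have "box_poly I D (P s)" for s
  proof -
    have "box_poly I (M * d) (\<lambda>x. (q j x + s j * p j x) ^ M)" if "j < M" for j
      using box_poly_mult[OF I box_poly_const[OF I, of 0 "s j"] p[OF that]]
      by (intro box_poly_power I box_poly_add q that) simp
    then show ?thesis
      unfolding P_def D_def using box_poly_prod[OF I, of "{..<M}" "M * d"] by simp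
  qed
  then obtain c where c: "\<And>s x. P s x = (\<Sum>e\<in>E. c s e * (\<Prod>i\<in>I. x i ^ e i))"
    unfolding box_poly_def E_def by metis
  have dom: "\<exists>x. (\<Sum>s\<in>T - {t}. \<bar>P s x\<bar>) < \<bar>P t x\<bar>" if t: "t \<in> T" for t
  proof -
    obtain x where x: "\<And>j. j < M \<Longrightarrow> q j x \<noteq> 0" "\<And>j. j < M \<Longrightarrow> \<bar>p j x / q j x - t j\<bar> \<le> 2 / 3"
      using close[OF t] by blast
    \<comment> \<open>Up to the power \<open>M\<close>, the value of \<open>P s\<close> at \<open>x\<close> is the product of the \<open>u s j\<close>. Common
      factors \<open>q j x\<close> are harmless, since only ratios of values at the same \<open>x\<close> matter.\<close>
    define u where "u = (\<lambda>s j. \<bar>q j x + s j * p j x\<bar>)"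
    have absP: "\<bar>P s x\<bar> = (\<Prod>j<M. u s j) ^ M" for s
      unfolding P_def u_def by (simp add: prod_power_distrib abs_prod power_abs)
    have u: "0 < u t j" "s j \<noteq> t j \<Longrightarrow> u s j \<le> u t j / 2" if j: "j < M" and s: "s \<in> T" for s j
    proof -
      define z where "z = p j x / q j x"
      have pz: "p j x = q j x * z" using x(1)[OF j] by (simp add: z_def)
      have uz: "u s j = \<bar>q j x\<bar> * \<bar>1 + s j * z\<bar>" for s
        unfolding u_def pz by (simp add: abs_mult [symmetric] algebra_simps)
      have z: "\<bar>z - t j\<bar> \<le> 2 / 3" using x(2)[OF j] by (simp add: z_def)
      have tj: "t j = 1 \<or> t j = - 1" and sj: "s j = 1 \<or> s j = - 1"
        using t s j unfolding T_def by (force simp: PiE_iff)+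
      have big: "\<bar>1 + t j * z\<bar> \<ge> 4 / 3" 
        using tj z abs_ge_self[of "1 + t j * z"] by (auto simp only: abs_le_iff)
      then have "0 < \<bar>1 + t j * z\<bar>" by linarith
      then show "0 < u t j" using x(1)[OF j] by (simp add: uz)
      assume "s j \<noteq> t j"
      then have "1 + s j * z = - t j * (z - t j)" using tj sj by auto
      then have "\<bar>1 + s j * z\<bar> = \<bar>z - t j\<bar>" using tj by (auto simp: abs_mult)
      then have "\<bar>1 + s j * z\<bar> \<le> 2 / 3" using z by simp
      moreover have "a \<le> b / 2" if "a \<le> 2 / 3" "4 / 3 \<le> b" for a b :: real using that by simp
      ultimately have "\<bar>1 + s j * z\<bar> \<le> \<bar>1 + t j * z\<bar> / 2" using big by blast
      then show "u s j \<le> u t j / 2" unfolding uz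
        using mult_left_mono[of _ _ "\<bar>q j x\<bar>"] by fastforce
    qed
    have Pt: "0 < \<bar>P t x\<bar>" unfolding absP using u(1)[OF _ t] by (intro zero_less_power prod_pos) auto
    have "\<bar>P s x\<bar> \<le> (1 / 2) ^ M * \<bar>P t x\<bar>" if s: "s \<in> T - {t}" for s
    proof -
      \<comment> \<open>One coordinate of disagreement gives the factor \<open>1 / 2\<close>, the exponent \<open>M\<close> then
        beats the number \<open>2 ^ M\<close> of competitors.\<close>
      have "\<exists>j0<M. s j0 \<noteq> t j0"
        using s t unfolding T_def by (metis DiffE PiE_ext insertI1 lessThan_iff)
      then obtain j0 where j0: "j0 < M" "s j0 \<noteq> t j0" by blast
      have le: "u s j \<le> u t j" if "j < M" for j
      proof (cases "s j = t j")
        case False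
        then show ?thesis using u[OF that, of s] s by auto
      qed (simp add: u_def)
      have "(\<Prod>j<M. u s j) = u s j0 * (\<Prod>j\<in>{..<M} - {j0}. u s j)"
        using j0 by (intro prod.remove) auto
      also have "\<dots> \<le> (u t j0 / 2) * (\<Prod>j\<in>{..<M} - {j0}. u t j)"
        using le u[OF j0(1), of s] s j0
        by (intro mult_mono prod_mono prod_nonneg) (auto simp: u_def)
      also have "\<dots> = 1 / 2 * (\<Prod>j<M. u t j)"
        using j0 by (subst prod.remove[of "{..<M}" j0]) auto
      finally have "(\<Prod>j<M. u s j) ^ M \<le> (1 / 2 * (\<Prod>j<M. u t j)) ^ M"
        by (intro power_mono prod_nonneg) (auto simp: u_def)
      then show ?thesis unfolding absP power_mult_distrib .
    qed
    then have "(\<Sum>s\<in>T - {t}. \<bar>P s x\<bar>) \<le> real (card (T - {t})) * ((1 / 2) ^ M * \<bar>P t x\<bar>)"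
      by (rule sum_bounded_above)
    also have "real (card (T - {t})) = 2 ^ M - 1"
      using t fin cardT by (simp add: of_nat_diff)
    also have "(2 ^ M - 1) * ((1 / 2) ^ M * \<bar>P t x\<bar>) = (1 - (1 / 2) ^ M) * \<bar>P t x\<bar>"
      by (simp add: power_one_over field_simps)
    also have "\<dots> < \<bar>P t x\<bar>" using Pt by simp
    finally show ?thesis by blast
  qed
  have "card T \<le> card E"
    by (rule card_le_of_dominant_witnesses[OF fin, of P c "\<lambda>e x. \<Prod>i\<in>I. x i ^ e i"]) (use c dom in auto)
  also have "card E = (D + 1) ^ card I" unfolding E_def using I by (simp add: card_PiE)
  finally show False using small cardT by (simp add: D_def)
qed

text \<open>
  Since \<open>1 + L \<le> 2 ^ L\<close>, the number \<open>M\<close> is at most \<open>2 ^ (8 + 2 * L)\<close>; the logarithm of the left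
  side is therefore at most \<open>n * (78 + 21 * L)\<close>. The factor \<open>256\<close> in \<open>M\<close> is chosen to exceed
  these constants.
\<close>
lemma box_dimension_less_sign_patterns:
  fixes L n M :: nat
  assumes n: "n = 2 ^ L" and M: "M = 256 * n * (1 + L)"
  shows "(M * (M * (n * M + 1)) + 1) ^ (3 * n) < 2 ^ M"
proof -
  have one: "b + 1 \<le> 2 ^ Suc k" if "b \<le> 2 ^ k" for b k :: nat
    using that one_le_power[of "2::nat" k] unfolding power_Suc by linarith
  have "1 + L \<le> 2 ^ L" using Suc_leI[OF less_exp[of L]] by simp
  then have "M \<le> 2 ^ 8 * 2 ^ L * 2 ^ L" unfolding M n by (intro mult_le_mono) auto
  also have "\<dots> = 2 ^ (8 + L + L)" by (simp only: power_add)
  finally have M': "M \<le> 2 ^ (8 + 2 * L)" by (simp only: mult_2 add.assoc)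
  have "n * M \<le> 2 ^ L * 2 ^ (8 + 2 * L)" unfolding n using M' by simp
  also have "\<dots> = 2 ^ (8 + 3 * L)" by (simp flip: power_add)
  finally have "n * M + 1 \<le> 2 ^ (9 + 3 * L)" using one by fastforce
  then have "M * (M * (n * M + 1)) \<le> 2 ^ (8 + 2 * L) * (2 ^ (8 + 2 * L) * 2 ^ (9 + 3 * L))"
    using M' by (intro mult_le_mono)
  also have "\<dots> = 2 ^ (25 + 7 * L)" by (simp flip: power_add)
  finally have "(M * (M * (n * M + 1)) + 1) ^ (3 * n) \<le> (2 ^ Suc (25 + 7 * L)) ^ (3 * n)"
    by (intro power_mono one) auto
  also have "\<dots> = 2 ^ (Suc (25 + 7 * L) * (3 * n))" by (simp only: power_mult)
  also have "\<dots> < 2 ^ M"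
  proof (rule power_strict_increasing)
    have "(78 + 21 * L) * n < (256 * (1 + L)) * n" unfolding n by (intro mult_strict_right_mono) auto
    then show "Suc (25 + 7 * L) * (3 * n) < M" unfolding M by (simp add: algebra_simps)
  qed simp
  finally show ?thesis .
qed

text \<open>
  At equidistant points the exponentials in the denominators of the neurons are monomials,
  \<open>exp (- (b * \<xi>\<^sub>j + c)) = exp (- (c + b / (2 * M))) * exp (- b / M) ^ j\<close>, so that the network
  values are rational in the parameters. The offsets \<open>F j\<close> enter only through the coefficients of
  the numerators, which is why any previously built function can be subtracted.
\<close>
lemma networks_miss_sign_vector:
  fixes L n M :: nat and F :: "nat \<Rightarrow> real"
  assumes n: "n = 2 ^ L" and M: "M = 256 * n * (1 + L)" and A: "A > 0"
  shows "\<exists>t \<in> {..<M} \<rightarrow>\<^sub>E {- 1, 1}. \<forall>g\<in>networks n logistic.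
           \<exists>j<M. 2 / 3 * A < \<bar>F j + A * t j - g ((real j + 1 / 2) / real M)\<bar>"
proof -
  define I where "I = {1..n} \<times> {..<3::nat}"
  \<comment> \<open>The variables \<open>x (k, 0)\<close>, \<open>x (k, 1)\<close>, \<open>x (k, 2)\<close> stand for \<open>a\<^sub>k\<close>, \<open>exp (- b\<^sub>k / M)\<close>
    and \<open>exp (- (c\<^sub>k + b\<^sub>k / (2 * M)))\<close>.\<close>
  define q where "q = (\<lambda>k j (x :: nat \<times> nat \<Rightarrow> real). 1 + x (k, 2) * x (k, 1) ^ j)"
  define den where "den = (\<lambda>j x. \<Prod>k\<in>{1..n}. q k j x)"
  define num where "num = (\<lambda>j x. 1 / A * ((\<Sum>k\<in>{1..n}. x (k, 0) * (\<Prod>l\<in>{1..n} - {k}. q l j x)) + (- F j) * den j x))"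
  have I: "finite I" "card I = 3 * n" by (auto simp: I_def)
  have Mpos: "M > 0" unfolding M n by simp
  have q: "box_poly I M (q k j)" if "k \<in> {1..n}" "j < M" for k j
  proof -
    have "box_poly I (1 + j * 1) (\<lambda>x. x (k, 2) * x (k, 1) ^ j)"
      by (intro box_poly_mult box_poly_power box_poly_var I) (use that in \<open>auto simp: I_def\<close>)
    then have "box_poly I M (\<lambda>x. x (k, 2) * x (k, 1) ^ j)"
      by (rule box_poly_mono[OF I(1)]) (use that in auto)
    then show ?thesis unfolding q_def by (intro box_poly_add box_poly_const I)
  qed
  have den: "box_poly I (n * M + 1) (den j)" if "j < M" for j
  proof -
    have "box_poly I (card {1..n} * M) (den j)"
      unfolding den_def by (intro box_poly_prod I q that) auto
    then show ?thesis by (rule box_poly_mono[OF I(1)]) simp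
  qed
  have num: "box_poly I (n * M + 1) (num j)" if "j < M" for j
  proof -
    have "box_poly I (n * M + 1) (\<lambda>x. x (k, 0) * (\<Prod>l\<in>{1..n} - {k}. q l j x))" if k: "k \<in> {1..n}" for k
    proof -
      have "box_poly I (1 + card ({1..n} - {k}) * M) (\<lambda>x. x (k, 0) * (\<Prod>l\<in>{1..n} - {k}. q l j x))"
        by (intro box_poly_mult box_poly_prod box_poly_var I q \<open>j < M\<close>) (use k in \<open>auto simp: I_def\<close>)
      moreover have "card ({1..n} - {k}) \<le> n" by (simp add: card_Diff_subset_Int)
      ultimately show ?thesis by (elim box_poly_mono[OF I(1)]) simp
    qed
    then have "box_poly I (n * M + 1) (\<lambda>x. \<Sum>k\<in>{1..n}. x (k, 0) * (\<Prod>l\<in>{1..n} - {k}. q l j x))"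
      by (rule box_poly_sum)
    moreover have "box_poly I (n * M + 1) (\<lambda>x. (- F j) * den j x)"
      using box_poly_mult[OF I(1) box_poly_const[OF I(1), of 0 "- F j"] den[OF that]] by simp
    ultimately have "box_poly I (0 + (n * M + 1)) (num j)"
      unfolding num_def by (rule box_poly_mult[OF I(1) box_poly_const[OF I(1)] box_poly_add])
    then show ?thesis by simp
  qed
  have "(M * (M * (n * M + 1)) + 1) ^ card I < 2 ^ M"
    unfolding I(2) by (rule box_dimension_less_sign_patterns[OF n M])
  then obtain t where t: "t \<in> {..<M} \<rightarrow>\<^sub>E {- 1, 1}"
    and miss: "\<And>x. (\<forall>j<M. den j x \<noteq> 0) \<Longrightarrow> \<exists>j<M. 2 / 3 < \<bar>num j x / den j x - t j\<bar>"
    using rational_map_misses_cube_vertex[where p = num and q = den, OF I(1) num den] by blast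
  have "\<exists>j<M. 2 / 3 * A < \<bar>F j + A * t j - g ((real j + 1 / 2) / real M)\<bar>"
    if "g \<in> networks n logistic" for g
  proof -
    from that obtain a b c :: "nat \<Rightarrow> real"
      where g: "\<And>x. x \<in> {0..1} \<Longrightarrow> g x = (\<Sum>k=1..n. a k * logistic (b k * x + c k))"
      unfolding networks_def by blast
    define x where "x = (\<lambda>(k, i). if i = 0 then a k
        else if i = Suc 0 then exp (- b k / M) else exp (- (c k + b k / (2 * M))))"
    have qx: "q k j x = 1 + exp (- (b k * ((real j + 1 / 2) / real M) + c k))" for k j
    proof -
      have "- (b k * ((real j + 1 / 2) / real M) + c k) = - (c k + b k / (2 * M)) + real j * (- b k / M)"
        using Mpos by (simp add: field_simps)
      then have "exp (- (b k * ((real j + 1 / 2) / real M) + c k))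
          = exp (- (c k + b k / (2 * M))) * exp (- b k / M) ^ j"
        by (simp only: exp_add exp_of_nat_mult)
      then show ?thesis by (simp add: q_def x_def)
    qed
    have qpos: "q k j x > 0" for k j unfolding qx by (simp add: add_pos_pos)
    then have den0: "den j x \<noteq> 0" for j by (auto simp: den_def less_imp_neq[symmetric])
    then obtain j where j: "j < M" "2 / 3 < \<bar>num j x / den j x - t j\<bar>" using miss by blast
    let ?\<xi> = "(real j + 1 / 2) / real M"
    have "?\<xi> \<in> {0..1}" using j(1) by (simp add: field_simps)
    then have "g ?\<xi> = (\<Sum>k=1..n. a k / q k j x)" by (simp add: g logistic_def qx)
    also have "\<dots> = (\<Sum>k=1..n. x (k, 0) * (\<Prod>l\<in>{1..n} - {k}. q l j x)) / den j x"
      unfolding sum_divide_distrib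
    proof (intro sum.cong refl)
      fix k assume "k \<in> {1..n}"
      then have "den j x = q k j x * (\<Prod>l\<in>{1..n} - {k}. q l j x)"
        unfolding den_def by (intro prod.remove) auto
      then show "a k / q k j x = x (k, 0) * (\<Prod>l\<in>{1..n} - {k}. q l j x) / den j x"
        using den0[of j] by (simp add: x_def)
    qed
    finally have "num j x / den j x = (g ?\<xi> - F j) / A"
      using den0[of j] A unfolding num_def by (simp add: field_simps)
    with j(2) A have "2 / 3 * A < \<bar>(g ?\<xi> - F j) / A - t j\<bar> * A" by simp
    also have "\<dots> = \<bar>F j + A * t j - g ?\<xi>\<bar>"
      using A by (simp add: abs_mult_pos' field_simps abs_minus_commute)
    finally show ?thesis using j(1) by blast
  qed
  with t show ?thesis by blast
qed

section \<open>Forward differences\<close>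

lemma fwd_diff_0 [simp]: "fwd_diff 0 h f x = f x"
  by (simp add: fwd_diff_def)

lemma fwd_diff_Suc: "fwd_diff (Suc r) h f x = fwd_diff r h f (x + h) - fwd_diff r h f x"
proof -
  let ?t = "\<lambda>j. f (x + real j * h)"
  have "fwd_diff (Suc r) h f x
      = (-1) ^ Suc r * ?t 0 + (\<Sum>j=0..r. (-1) ^ (r - j) * real (Suc r choose Suc j) * ?t (Suc j))"
    unfolding fwd_diff_def by (subst sum.atLeast0_atMost_Suc_shift) simp
  also have "\<dots> = (-1) ^ Suc r * ?t 0 + (\<Sum>j=0..r. (-1) ^ (r - j) * real (r choose j) * ?t (Suc j))
      + (\<Sum>j=0..r. (-1) ^ (r - j) * real (r choose Suc j) * ?t (Suc j))"
    by (simp add: sum.distrib [symmetric] algebra_simps)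
  also have "(\<Sum>j=0..r. (-1) ^ (r - j) * real (r choose j) * ?t (Suc j)) = fwd_diff r h f (x + h)"
    unfolding fwd_diff_def by (simp add: algebra_simps)
  also have "(-1) ^ Suc r * ?t 0 + fwd_diff r h f (x + h)
        + (\<Sum>j=0..r. (-1) ^ (r - j) * real (r choose Suc j) * ?t (Suc j))
      = fwd_diff r h f (x + h)
        - ((-1) ^ r * ?t 0 + (\<Sum>j=0..<r. (-1) ^ (r - Suc j) * real (r choose Suc j) * ?t (Suc j)))"
  proof -
    have "(\<Sum>j=0..r. (-1) ^ (r - j) * real (r choose Suc j) * ?t (Suc j))
        = (\<Sum>j=0..<r. (-1) ^ (r - j) * real (r choose Suc j) * ?t (Suc j))"
      by (simp add: sum.last_plus atLeast0LessThan lessThan_Suc_atMost [symmetric] atLeast0AtMost)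
    also have "\<dots> = (\<Sum>j=0..<r. - ((-1) ^ (r - Suc j) * real (r choose Suc j) * ?t (Suc j)))"
    proof (intro sum.cong refl)
      fix j assume "j \<in> {0..<r}"
      then have "r - j = Suc (r - Suc j)" by auto
      then show "(-1) ^ (r - j) * real (r choose Suc j) * ?t (Suc j)
          = - ((-1) ^ (r - Suc j) * real (r choose Suc j) * ?t (Suc j))" by simp
    qed
    finally show ?thesis by (simp add: sum_negf)
  qed
  also have "(-1) ^ r * ?t 0 + (\<Sum>j=0..<r. (-1) ^ (r - Suc j) * real (r choose Suc j) * ?t (Suc j))
      = fwd_diff r h f x"
    unfolding fwd_diff_def
    by (cases r) (simp_all add: sum.atLeast0_atMost_Suc_shift atLeastLessThanSuc_atLeastAtMost del: sum.cl_ivl_Suc)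
  finally show ?thesis .
qed

lemma fwd_diff_scale: "fwd_diff r h (\<lambda>x. f (m * x)) x = fwd_diff r (m * h) f (m * x)"
  by (simp add: fwd_diff_def algebra_simps)

lemma abs_fwd_diff_le:
  assumes "\<And>x. \<bar>f x\<bar> \<le> B"
  shows "\<bar>fwd_diff r h f x\<bar> \<le> 2 ^ r * B"
proof (induction r arbitrary: x)
  case (Suc r)
  have "\<bar>fwd_diff (Suc r) h f x\<bar> \<le> \<bar>fwd_diff r h f (x + h)\<bar> + \<bar>fwd_diff r h f x\<bar>"
    unfolding fwd_diff_Suc by linarith
  also have "\<dots> \<le> 2 ^ Suc r * B" using Suc[of "x + h"] Suc[of x] by simp
  finally show ?case .
qed (use assms in simp)

lemma fwd_diff_sums:
  assumes "\<And>y. (\<lambda>k. f k y) sums g y"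
  shows "(\<lambda>k. fwd_diff r h (f k) x) sums fwd_diff r h g x"
  unfolding fwd_diff_def by (intro sums_sum sums_mult assms)

lemma has_real_derivative_fwd_diff:
  assumes "\<And>y. (f has_real_derivative f' y) (at y)"
  shows "(fwd_diff r h f has_real_derivative fwd_diff r h f' x) (at x)"
proof -
  have "((\<lambda>x. f (x + c)) has_real_derivative f' (x + c)) (at x)" for c
    using assms[of "x + c"] by (simp add: DERIV_shift)
  then show ?thesis unfolding fwd_diff_def
    by (intro DERIV_sum DERIV_cmult)
qed

lemma abs_fwd_diff_Suc_le_derivative:
  assumes "\<And>y. (f has_real_derivative f' y) (at y)"
    and "\<And>y. \<bar>fwd_diff r h f' y\<bar> \<le> B" and "h > 0"
  shows "\<bar>fwd_diff (Suc r) h f x\<bar> \<le> h * B"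
proof -
  obtain z where "fwd_diff r h f (x + h) - fwd_diff r h f x = (x + h - x) * fwd_diff r h f' z"
    using MVT2[of x "x + h" "fwd_diff r h f" "fwd_diff r h f'"]
      has_real_derivative_fwd_diff[OF assms(1)] \<open>h > 0\<close> by auto
  then show ?thesis using assms(2)[of z] \<open>h > 0\<close>
    by (simp add: fwd_diff_Suc abs_mult)
qed

section \<open>Smooth humps with free signs\<close>

text \<open>
  Bumps on the unit intervals between consecutive integers, the one on \<open>[i, i + 1]\<close> multiplied by
  \<open>s i\<close>. The zero of \<open>sin (pi * y) ^ k\<close> at the integers absorbs the jumps of \<open>s\<close>. The factor
  \<open>poly q (cos (pi * y))\<close> makes the family closed under differentiation.
\<close>
definition signed_wave :: "(int \<Rightarrow> real) \<Rightarrow> nat \<Rightarrow> real poly \<Rightarrow> real \<Rightarrow> real" where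
  "signed_wave s k q y = s \<lfloor>y\<rfloor> * (sin (pi * y) ^ k * poly q (cos (pi * y)))"

text \<open>
  From \<open>d/dy (sin\<^sup>k q(cos)) = pi * sin\<^sup>k\<^sup>-\<^sup>1 * (k * cos * q(cos) - sin\<^sup>2 * q'(cos))\<close> with
  arguments \<open>pi * y\<close>, where \<open>sin\<^sup>2\<close> is rewritten as \<open>1 - cos\<^sup>2\<close>.
\<close>
definition wave_deriv_poly :: "nat \<Rightarrow> real poly \<Rightarrow> real poly" where
  "wave_deriv_poly k q = smult pi (smult (real k) ([:0, 1:] * q) - [:1, 0, -1:] * pderiv q)"

text \<open>
  Between integers the sign is locally constant. At an integer the unsigned wave has a zero of
  order at least two, and the bounded signs do not affect that the difference quotient tends to
  zero.
\<close>
lemma signed_wave_has_derivative: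
  assumes s: "\<And>i. \<bar>s i\<bar> \<le> 1"
  shows "(signed_wave s (Suc (Suc k)) q has_real_derivative
           signed_wave s (Suc k) (wave_deriv_poly (Suc (Suc k)) q) y) (at y)"
proof -
  define u where "u = (\<lambda>y. sin (pi * y) ^ Suc (Suc k) * poly q (cos (pi * y)))"
  define u' where "u' = (\<lambda>y. sin (pi * y) ^ Suc k * poly (wave_deriv_poly (Suc (Suc k)) q) (cos (pi * y)))"
  have u: "(u has_real_derivative u' y) (at y)" for y
  proof -
    have sq: "1 - cos (pi * y) * cos (pi * y) = sin (pi * y) * sin (pi * y)"
      using sin_squared_eq[of "pi * y"] by (simp add: power2_eq_square)
    have "(u has_real_derivative
        (real (Suc (Suc k)) * sin (pi * y) ^ Suc k * (cos (pi * y) * pi)) * poly q (cos (pi * y))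
        + poly (pderiv q) (cos (pi * y)) * (- sin (pi * y) * pi) * sin (pi * y) ^ Suc (Suc k)) (at y)"
      unfolding u_def
      by (rule DERIV_mult)
        (rule derivative_eq_intros poly_DERIV DERIV_chain2[OF poly_DERIV] refl | simp)+
    also have "(real (Suc (Suc k)) * sin (pi * y) ^ Suc k * (cos (pi * y) * pi)) * poly q (cos (pi * y))
        + poly (pderiv q) (cos (pi * y)) * (- sin (pi * y) * pi) * sin (pi * y) ^ Suc (Suc k)
      = sin (pi * y) ^ Suc k * (pi * (real (Suc (Suc k)) * (cos (pi * y) * poly q (cos (pi * y)))
          - (sin (pi * y) * sin (pi * y)) * poly (pderiv q) (cos (pi * y))))"
      by (simp add: algebra_simps)
    also have "\<dots> = u' y" 
      unfolding u'_def wave_deriv_poly_def sq[symmetric] by (simp add: algebra_simps)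
    finally show ?thesis .
  qed
  have G: "signed_wave s (Suc (Suc k)) q = (\<lambda>y. s \<lfloor>y\<rfloor> * u y)"
    "signed_wave s (Suc k) (wave_deriv_poly (Suc (Suc k)) q) = (\<lambda>y. s \<lfloor>y\<rfloor> * u' y)"
    by (auto simp: signed_wave_def u_def u'_def)
  show ?thesis
  proof (cases "y \<in> \<int>")
    case False
    define l where "l = real_of_int \<lfloor>y\<rfloor>"
    have ly: "l < y" "y < l + 1"
      using False floor_correct[of y] unfolding l_def by (metis Ints_of_int less_eq_real_def) auto
    have "((\<lambda>z. s \<lfloor>y\<rfloor> * u z) has_real_derivative s \<lfloor>y\<rfloor> * u' y) (at y)"
      by (intro DERIV_cmult u)
    moreover have "\<forall>\<^sub>F z in nhds y. s \<lfloor>y\<rfloor> * u z = s \<lfloor>z\<rfloor> * u z"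
    proof -
      have "\<forall>\<^sub>F z in nhds y. z \<in> {l<..<l+1}" using ly by (intro eventually_nhds_in_open) auto
      then show ?thesis
      proof eventually_elim
        case (elim z)
        then have "\<lfloor>z\<rfloor> = \<lfloor>y\<rfloor>" by (intro floor_unique) (auto simp: l_def)
        then show ?case by simp
      qed
    qed
    ultimately show ?thesis unfolding G by (subst DERIV_cong_ev[OF refl _ refl, symmetric])
  next
    case True
    then have "sin (pi * y) = 0" by (auto elim!: Ints_cases simp: mult.commute sin_zero_iff_int2)
    then have 0: "u y = 0" "u' y = 0" by (auto simp: u_def u'_def)
    have "((\<lambda>z. u z / (z - y)) \<longlongrightarrow> 0) (at y)"
      using u[of y] unfolding has_field_derivative_iff 0 by simp
    then have "((\<lambda>z. s \<lfloor>z\<rfloor> * u z / (z - y)) \<longlongrightarrow> 0) (at y)"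
    proof (rule Lim_null_comparison[rotated, OF tendsto_rabs_zero])
      show "\<forall>\<^sub>F z in at y. norm (s \<lfloor>z\<rfloor> * u z / (z - y)) \<le> \<bar>u z / (z - y)\<bar>"
        using s mult_right_mono[OF s] by (intro always_eventually) (auto simp: abs_mult intro!: divide_right_mono mult_left_le_one_le)
    qed
    then show ?thesis unfolding G has_field_derivative_iff 0 by simp
  qed
qed

lemma signed_wave_bounded: "\<exists>B\<ge>0. \<forall>s y. (\<forall>i. \<bar>s i\<bar> \<le> 1) \<longrightarrow> \<bar>signed_wave s k q y\<bar> \<le> B"
proof -
  have "compact (poly q ` {-1..1})" by (intro compact_continuous_image continuous_intros) auto
  then obtain B where B: "\<And>x. x \<in> {-1..1} \<Longrightarrow> \<bar>poly q x\<bar> \<le> B" 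
    by (meson bounded_real compact_imp_bounded image_eqI)
  have "\<bar>signed_wave s k q y\<bar> \<le> B" if s: "\<forall>i. \<bar>s i\<bar> \<le> 1" for s y
  proof -
    have "\<bar>signed_wave s k q y\<bar> = (\<bar>s \<lfloor>y\<rfloor>\<bar> * \<bar>sin (pi * y)\<bar> ^ k) * \<bar>poly q (cos (pi * y))\<bar>"
      by (simp add: signed_wave_def abs_mult power_abs mult.assoc)
    also have "\<dots> \<le> 1 * B"
      using s B[of "cos (pi * y)"] by (intro mult_mono mult_le_one power_le_one) auto
    finally show ?thesis by simp
  qed
  moreover have "B \<ge> 0" using B[of 0] by force
  ultimately show ?thesis by blast
qed

text \<open>
  Each difference is traded for a derivative by the mean value theorem, which costs one power of
  the sine; \<open>Suc r\<close> powers suffice for \<open>r\<close> differences. The constant does not depend on the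
  signs, which is what allows the signs to be chosen afterwards.
\<close>
lemma fwd_diff_signed_wave:
  "\<exists>C\<ge>0. \<forall>s h y. (\<forall>i. \<bar>s i\<bar> \<le> 1) \<longrightarrow> 0 < h \<longrightarrow> \<bar>fwd_diff r h (signed_wave s (Suc r) q) y\<bar> \<le> C * h ^ r"
proof (induction r arbitrary: q)
  case 0
  show ?case using signed_wave_bounded[of "Suc 0" q] by fastforce
next
  case (Suc r)
  from Suc[of "wave_deriv_poly (Suc (Suc r)) q"] obtain C where C: "C \<ge> 0"
    "\<And>s h y. \<lbrakk>\<forall>i. \<bar>s i\<bar> \<le> 1; 0 < h\<rbrakk> \<Longrightarrow>
       \<bar>fwd_diff r h (signed_wave s (Suc r) (wave_deriv_poly (Suc (Suc r)) q)) y\<bar> \<le> C * h ^ r"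
    by blast
  have "\<bar>fwd_diff (Suc r) h (signed_wave s (Suc (Suc r)) q) y\<bar> \<le> C * h ^ Suc r"
    if "\<forall>i. \<bar>s i\<bar> \<le> 1" "0 < h" for s h y
    using abs_fwd_diff_Suc_le_derivative[OF signed_wave_has_derivative C(2)[OF that] that(2), where x=y] that
    by (simp add: mult_ac)
  then show ?case using C(1) by blast
qed

lemma networks_miss_signed_wave:
  fixes L n M :: nat and F :: "real \<Rightarrow> real"
  assumes n: "n = 2 ^ L" and M: "M = 256 * n * (1 + L)" and A: "A > 0"
  shows "\<exists>s. (\<forall>i. \<bar>s i\<bar> \<le> 1) \<and> (\<forall>g\<in>networks n logistic. \<exists>x\<in>{0..1}.
           2 / 3 * A < \<bar>F x + A * signed_wave s k 1 (real M * x) - g x\<bar>)"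
proof -
  let ?\<xi> = "\<lambda>j. (real j + 1 / 2) / real M"
  obtain t where t: "t \<in> {..<M} \<rightarrow>\<^sub>E {- 1, 1}"
    and miss: "\<And>g. g \<in> networks n logistic \<Longrightarrow>
      \<exists>j<M. 2 / 3 * A < \<bar>F (?\<xi> j) + A * t j - g (?\<xi> j)\<bar>"
    using networks_miss_sign_vector[OF n M A, of "\<lambda>j. F (?\<xi> j)"] by blast
  \<comment> \<open>The power of \<open>- 1\<close> compensates the sign of the sine at the centre of the \<open>j\<close>-th bump.\<close>
  define s where "s = (\<lambda>i. if 0 \<le> i \<and> i < int M then t (nat i) * ((- 1) ^ nat i) ^ k else 0)"
  have tj: "t j = 1 \<or> t j = - 1" if "j < M" for j using t that by (force simp: PiE_iff)
  have "\<bar>s i\<bar> \<le> 1" for i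
  proof (cases "0 \<le> i \<and> i < int M")
    case True
    then have "\<bar>t (nat i)\<bar> = 1" using tj[of "nat i"] by (auto simp: nat_less_iff)
    then show ?thesis using True by (simp add: s_def abs_mult power_abs)
  qed (auto simp: s_def)
  moreover have "signed_wave s k 1 (real M * ?\<xi> j) = t j" if "j < M" for j
  proof -
    have "real M * ?\<xi> j = real j + 1 / 2" using that by simp
    moreover have "\<lfloor>real j + 1 / 2\<rfloor> = int j" by (rule floor_unique) auto
    moreover have "sin (pi * (real j + 1 / 2)) = (- 1) ^ j"
      by (simp add: distrib_left sin_add mult.commute[of pi] cos_npi)
    ultimately show ?thesis using that
      by (simp add: signed_wave_def s_def power_mult_distrib [symmetric] flip: mult.assoc)
  qed
  moreover have "?\<xi> j \<in> {0..1}" if "j < M" for j using that by (simp add: field_simps)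
  ultimately show ?thesis using miss by (intro exI[of _ s]) (metis (no_types, lifting))
qed

section \<open>Abstract moduli of smoothness\<close>

lemma abstract_modulus_mono: "abstract_modulus \<omega> \<Longrightarrow> 0 \<le> x \<Longrightarrow> x \<le> y \<Longrightarrow> \<omega> x \<le> \<omega> y"
  unfolding abstract_modulus_def mono_on_def by auto

lemma abstract_modulus_pos: "abstract_modulus \<omega> \<Longrightarrow> 0 < x \<Longrightarrow> 0 < \<omega> x"
  unfolding abstract_modulus_def by blast

lemma abstract_modulus_nat_mult:
  assumes w: "abstract_modulus \<omega>" and x: "0 < x"
  shows "\<omega> (real (Suc m) * x) \<le> real (Suc m) * \<omega> x"
proof (induction m)
  case (Suc m)
  have "\<omega> (real (Suc (Suc m)) * x) = \<omega> (real (Suc m) * x + x)" by (simp add: algebra_simps)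
  also have "\<dots> \<le> \<omega> (real (Suc m) * x) + \<omega> x"
    using w x unfolding abstract_modulus_def by simp
  finally show ?case using Suc by (simp add: algebra_simps)
qed simp

text \<open>
  Subadditivity makes \<open>\<omega> x / x\<close> almost decreasing: cover \<open>[0, y]\<close> by at most \<open>2 * y / x\<close> intervals
  of length \<open>x\<close>.
\<close>
lemma abstract_modulus_ratio:
  assumes w: "abstract_modulus \<omega>" and "0 < x" "x \<le> y"
  shows "\<omega> y / y \<le> 2 * (\<omega> x / x)"
proof -
  define m where "m = nat \<lfloor>y / x\<rfloor>"
  have 1: "1 \<le> y / x" using assms by simp
  then have m: "real m = of_int \<lfloor>y / x\<rfloor>" by (simp add: m_def)
  have "y / x \<le> real (Suc m)" using m floor_correct[of "y / x"] by (simp add: less_imp_le add.commute)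
  then have "\<omega> y \<le> \<omega> (real (Suc m) * x)"
    using assms by (intro abstract_modulus_mono[OF w]) (auto simp: field_simps)
  also have "\<dots> \<le> real (Suc m) * \<omega> x" using assms by (intro abstract_modulus_nat_mult)
  also have "\<dots> \<le> (2 * (y / x)) * \<omega> x"
  proof (rule mult_right_mono)
    show "real (Suc m) \<le> 2 * (y / x)" using m of_int_floor_le[of "y / x"] 1 by linarith
    show "0 \<le> \<omega> x" using abstract_modulus_pos[OF w \<open>0 < x\<close>] by simp
  qed
  finally show ?thesis using assms by (simp add: field_simps)
qed

lemma abstract_modulus_tendsto_0:
  assumes "abstract_modulus \<omega>"
  shows "(\<omega> \<longlongrightarrow> 0) (at_right 0)"
proof -
  have "(\<omega> \<longlongrightarrow> \<omega> 0) (at 0 within {0..})"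
    using assms unfolding abstract_modulus_def continuous_on_def by (metis atLeast_iff order_refl)
  then show ?thesis
    using assms unfolding abstract_modulus_def by (auto intro: tendsto_within_subset)
qed

section \<open>Lacunary series of humps\<close>

lemma exists_lacunary_subsequence:
  fixes a b :: "nat \<Rightarrow> real"
  assumes a: "\<And>n. a n > 0" "a \<longlonglongrightarrow> 0" and b: "filterlim b at_top sequentially"
  shows "\<exists>\<phi>. strict_mono \<phi> \<and> (\<forall>k. a (\<phi> (Suc k)) \<le> a (\<phi> k) / 4) \<and> (\<forall>k. 2 * b (\<phi> k) \<le> b (\<phi> (Suc k)))"
proof -
  have "\<exists>\<phi>. \<forall>k. \<phi> k < \<phi> (Suc k) \<and> a (\<phi> (Suc k)) \<le> a (\<phi> k) / 4 \<and> 2 * b (\<phi> k) \<le> b (\<phi> (Suc k))"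
  proof (rule dependent_nat_choice[where P = "\<lambda>_ _. True", simplified])
    fix x :: nat
    have "\<forall>\<^sub>F y in sequentially. a y < a x / 4" using a by (intro order_tendstoD) auto
    moreover have "\<forall>\<^sub>F y in sequentially. 2 * b x \<le> b y"
      using b by (auto simp: filterlim_at_top)
    moreover have "\<forall>\<^sub>F y in sequentially. x < y" by (rule eventually_gt_at_top)
    ultimately have "\<forall>\<^sub>F y in sequentially. x < y \<and> a y \<le> a x / 4 \<and> 2 * b x \<le> b y"
      by eventually_elim auto
    then show "\<exists>y>x. a y \<le> a x / 4 \<and> 2 * b x \<le> b y"
      by (auto dest: eventually_happens)
  qed
  then show ?thesis by (auto simp: strict_mono_Suc_iff)
qed

lemma geometric_decay_tail:
  fixes a w :: "nat \<Rightarrow> real"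
  assumes a: "\<And>k. 0 \<le> a k" "\<And>k. a (Suc k) \<le> a k / 4" and w: "\<And>k. \<bar>w k\<bar> \<le> B"
  shows "summable (\<lambda>i. a (i + K) * w i)" "\<bar>\<Sum>i. a (i + K) * w i\<bar> \<le> 4 / 3 * B * a K"
proof -
  have a': "a (i + K) \<le> a K * (1 / 4) ^ i" for i
  proof (induction i)
    case (Suc i)
    then show ?case using a(2)[of "i + K"] by simp
  qed simp
  have le: "norm (a (i + K) * w i) \<le> (a K * B) * (1 / 4) ^ i" for i
  proof -
    have "norm (a (i + K) * w i) \<le> (a K * (1 / 4) ^ i) * B"
      using a'[of i] w[of i] a(1) by (auto simp: abs_mult intro!: mult_mono)
    then show ?thesis by (simp add: mult_ac)
  qed
  have s: "(\<lambda>i. (a K * B) * (1 / 4) ^ i) sums ((a K * B) * (1 / (1 - 1 / 4)))"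
    by (intro sums_mult geometric_sums) simp
  show sm: "summable (\<lambda>i. a (i + K) * w i)"
    by (rule summable_comparison_test'[OF sums_summable[OF s], of 0]) (use le in auto)
  have "norm (\<Sum>i. a (i + K) * w i) \<le> (\<Sum>i. (a K * B) * (1 / 4) ^ i)"
    by (rule norm_suminf_le[OF le sums_summable[OF s]])
  also have "\<dots> = (a K * B) * (1 / (1 - 1 / 4))" by (rule sums_unique[OF s, symmetric])
  finally show "\<bar>\<Sum>i. a (i + K) * w i\<bar> \<le> 4 / 3 * B * a K"
    by (simp add: field_simps)
qed

lemma sum_doubling_le:
  fixes b :: "nat \<Rightarrow> real"
  assumes "\<And>k. 2 * b k \<le> b (Suc k)" "b 0 \<ge> 0"
  shows "(\<Sum>i<Suc K. b i) \<le> 2 * b K"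
proof (induction K)
  case (Suc K)
  then show ?case using assms(1)[of K] by simp
qed (use assms in simp)

text \<open>
  Split the series at the last \<open>K\<close> with \<open>M K * h \<le> 1\<close>. Above \<open>K\<close> the trivial bound \<open>2 ^ r\<close> for the
  differences is used, and the amplitudes form a geometric series dominated by
  \<open>A (Suc K) \<le> \<omega> (h ^ r)\<close>. Up to \<open>K\<close> the smoothness of the humps is used, and the terms
  \<open>A k * M k ^ r\<close> are dominated by the last one, which is at most \<open>2 * \<omega> (h ^ r) / h ^ r\<close>
  because \<open>\<omega> x / x\<close> is almost decreasing.
\<close>
lemma fwd_diff_lacunary_series:
  fixes \<omega> f :: "real \<Rightarrow> real" and A M :: "nat \<Rightarrow> real" and w :: "nat \<Rightarrow> real \<Rightarrow> real"
  assumes \<omega>: "abstract_modulus \<omega>"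
    and M: "\<And>k. 0 < M k" "filterlim M at_top sequentially"
    and A: "\<And>k. A k = \<omega> ((1 / M k) ^ r)" "\<And>k. A (Suc k) \<le> A k / 4"
    and AM: "\<And>k. 2 * (A k * M k ^ r) \<le> A (Suc k) * M (Suc k) ^ r"
    and w1: "\<And>k x. \<bar>w k x\<bar> \<le> 1"
    and wr: "\<And>k h x. 0 < h \<Longrightarrow> \<bar>fwd_diff r h (w k) x\<bar> \<le> C * (M k * h) ^ r"
    and f: "\<And>x. (\<lambda>k. A k * w k x) sums f x"
    and C: "0 \<le> C" and h: "0 < h" "M 0 * h \<le> 1"
  shows "\<bar>fwd_diff r h f x\<bar> \<le> (4 * C + 4 / 3 * 2 ^ r) * \<omega> (h ^ r)"
proof -
  let ?D = "\<lambda>k. fwd_diff r h (w k) x"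
  have Apos: "0 < A k" for k using abstract_modulus_pos[OF \<omega>] M(1) by (simp add: A(1))
  have "\<exists>k. 1 < M k * h"
  proof -
    have "\<forall>\<^sub>F k in sequentially. 1 / h < M k" using M(2) by (simp add: filterlim_at_top_dense)
    then show ?thesis using h(1) by (auto simp: field_simps dest!: eventually_happens)
  qed
  define K' where "K' = (LEAST k. 1 < M k * h)"
  have K': "1 < M K' * h" unfolding K'_def using \<open>\<exists>k. 1 < M k * h\<close> by (rule LeastI_ex)
  then have "K' \<noteq> 0" using h(2) by (intro notI) simp
  then obtain K where K: "K' = Suc K" using not0_implies_Suc by blast
  have "M K * h \<le> 1" using not_less_Least[of K "\<lambda>k. 1 < M k * h"] K unfolding K'_def by auto
  have hr: "0 < h ^ r" using h(1) by simp
  have lin: "fwd_diff r h (\<lambda>x. A k * w k x) x = A k * ?D k" for k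
    by (simp add: fwd_diff_def sum_distrib_left mult_ac)
  have sums: "(\<lambda>k. A k * ?D k) sums fwd_diff r h f x"
    using fwd_diff_sums[of "\<lambda>k x. A k * w k x" f r h x, OF f] unfolding lin .
  have split: "fwd_diff r h f x = (\<Sum>i. A (i + Suc K) * ?D (i + Suc K)) + (\<Sum>i<Suc K. A i * ?D i)"
    using suminf_split_initial_segment[OF sums_summable[OF sums], of "Suc K"] sums_unique[OF sums] by simp
  have "\<bar>\<Sum>i. A (i + Suc K) * ?D (i + Suc K)\<bar> \<le> 4 / 3 * 2 ^ r * A (Suc K)"
    using Apos A(2) abs_fwd_diff_le[OF w1] by (intro geometric_decay_tail) (auto intro: less_imp_le)
  also have "A (Suc K) \<le> \<omega> (h ^ r)"
    unfolding A(1) using K' K M(1)[of "Suc K"] h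
    by (intro abstract_modulus_mono[OF \<omega>] power_mono) (auto simp: field_simps less_imp_le)
  finally have high: "\<bar>\<Sum>i. A (i + Suc K) * ?D (i + Suc K)\<bar> \<le> 4 / 3 * 2 ^ r * \<omega> (h ^ r)"
    by simp
  have "\<bar>\<Sum>i<Suc K. A i * ?D i\<bar> \<le> (\<Sum>i<Suc K. (C * h ^ r) * (A i * M i ^ r))"
  proof (rule order_trans[OF sum_abs sum_mono])
    fix i
    have "A i * \<bar>?D i\<bar> \<le> A i * (C * (M i * h) ^ r)"
      using wr[OF h(1)] Apos[of i] by (intro mult_left_mono) auto
    then show "\<bar>A i * ?D i\<bar> \<le> (C * h ^ r) * (A i * M i ^ r)"
      using Apos[of i] by (simp add: abs_mult power_mult_distrib mult_ac)
  qed
  also have "\<dots> = (C * h ^ r) * (\<Sum>i<Suc K. A i * M i ^ r)" by (simp only: sum_distrib_left)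
  also have "\<dots> \<le> (C * h ^ r) * (2 * (A K * M K ^ r))"
    using C hr Apos[of 0] M(1)[of 0] by (intro mult_left_mono sum_doubling_le AM) auto
  finally have *: "\<bar>\<Sum>i<Suc K. A i * ?D i\<bar> \<le> (C * h ^ r) * (2 * (A K * M K ^ r))" .
  have **: "A K * M K ^ r \<le> 2 * (\<omega> (h ^ r) / h ^ r)"
  proof -
    have "h ^ r \<le> (1 / M K) ^ r"
      using \<open>M K * h \<le> 1\<close> M(1)[of K] h by (intro power_mono) (auto simp: field_simps)
    then have "\<omega> ((1 / M K) ^ r) / (1 / M K) ^ r \<le> 2 * (\<omega> (h ^ r) / h ^ r)"
      using hr by (intro abstract_modulus_ratio[OF \<omega>])
    then show ?thesis unfolding A(1) by (simp add: power_one_over field_simps)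
  qed
  have low: "\<bar>\<Sum>i<Suc K. A i * ?D i\<bar> \<le> 4 * C * \<omega> (h ^ r)"
  proof -
    have "(C * h ^ r) * (2 * (A K * M K ^ r)) \<le> (C * h ^ r) * (2 * (2 * (\<omega> (h ^ r) / h ^ r)))"
      using ** C hr by (intro mult_left_mono) auto
    also have "\<dots> = 4 * C * \<omega> (h ^ r)" using h(1) by simp
    finally show ?thesis using * by linarith
  qed
  show ?thesis unfolding split using high low by (simp add: algebra_simps del: sum.lessThan_Suc)
qed

section \<open>Sharpness of the error bound\<close>

lemma abs_smoothness_modulus_le:
  assumes "0 < \<delta>" and B: "\<And>h x. 0 < h \<Longrightarrow> h \<le> \<delta> \<Longrightarrow> \<bar>fwd_diff r h f x\<bar> \<le> B"
  shows "\<bar>smoothness_modulus r f \<delta>\<bar> \<le> B"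
proof -
  let ?S = "{\<bar>fwd_diff r h f x\<bar> | x h. x \<in> {0..1 - real r * h} \<and> 0 < h \<and> h \<le> \<delta>}"
  \<comment> \<open>A step for which \<open>0\<close> lies in \<open>{0..1 - r * h}\<close>, so that the set is not empty.\<close>
  define h where "h = min \<delta> (1 / real (Suc r))"
  have "real r * h \<le> real r * (1 / real (Suc r))" unfolding h_def by (intro mult_left_mono) auto
  also have "\<dots> \<le> 1" by simp
  finally have mem: "\<bar>fwd_diff r h f 0\<bar> \<in> ?S" using assms(1) by (force simp: h_def)
  have le: "y \<le> B" if "y \<in> ?S" for y using that B by auto
  have "Sup ?S \<le> B" using mem le by (intro cSup_least) auto
  moreover have "\<bar>fwd_diff r h f 0\<bar> \<le> Sup ?S"
    using mem le by (intro cSup_upper bdd_aboveI[of _ B]) auto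
  ultimately show ?thesis unfolding smoothness_modulus_def by linarith
qed

lemma best_approx_error_ge:
  assumes f: "continuous_on {0..1} f"
    and far: "\<And>g. g \<in> networks n logistic \<Longrightarrow> \<exists>x\<in>{0..1}. c \<le> \<bar>f x - g x\<bar>"
  shows "c \<le> best_approx_error (networks n logistic) f"
  unfolding best_approx_error_def
proof (rule cINF_greatest)
  have "(\<lambda>x. \<Sum>k=1..n. (0::real) * logistic (0 * x + 0)) \<in> networks n logistic"
    unfolding networks_def by (intro CollectI exI ballI) (rule refl)
  then show "networks n logistic \<noteq> {}" by blast
next
  fix g assume g: "g \<in> networks n logistic"
  then obtain a b d :: "nat \<Rightarrow> real"
    where eq: "\<And>x. x \<in> {0..1} \<Longrightarrow> g x = (\<Sum>k=1..n. a k * logistic (b k * x + d k))"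
    unfolding networks_def by blast
  have "1 + exp (- x) \<noteq> 0" for x :: real using exp_gt_zero[of "- x"] by linarith
  then have "continuous_on UNIV logistic"
    unfolding logistic_def by (intro continuous_intros) auto
  then have "continuous_on {0..1} (\<lambda>x. logistic (b k * x + d k))" for k
    by (rule continuous_on_compose2) (auto intro!: continuous_intros)
  then have "continuous_on {0..1} (\<lambda>x. \<bar>f x - (\<Sum>k=1..n. a k * logistic (b k * x + d k))\<bar>)"
    by (intro continuous_intros f)
  then have "continuous_on {0..1} (\<lambda>x. \<bar>f x - g x\<bar>)"
    by (rule continuous_on_eq) (simp add: eq)
  then have "bdd_above ((\<lambda>x. \<bar>f x - g x\<bar>) ` {0..1})"
    by (intro compact_imp_bounded[THEN bounded_imp_bdd_above] compact_continuous_image) auto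
  then show "c \<le> (SUP x\<in>{0..1}. \<bar>f x - g x\<bar>)"
    using far[OF g] cSUP_upper by (metis (no_types, lifting) order_trans)
qed

theorem corollary4p4:
  fixes r :: nat and \<omega> :: "real \<Rightarrow> real"
  assumes "r \<ge> 1"
    and "abstract_modulus \<omega>"
    and "filterlim (\<lambda>\<delta>. \<omega> \<delta> / \<delta>) at_top (at_right 0)"
  shows "\<exists>f :: real \<Rightarrow> real.
           continuous_on {0..1} f \<and>
           (\<lambda>\<delta>. smoothness_modulus r f \<delta>) \<in> O[at_right 0](\<lambda>\<delta>. \<omega> (\<delta> ^ r)) \<and>
           (\<lambda>n. best_approx_error (networks n logistic) f)
             \<notin> o[at_top](\<lambda>n::nat. \<omega> (1 / (real n * (1 + log 2 (real n))) ^ r))"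
proof -
  note \<omega> = assms(2)
  define N where "N = (\<lambda>L::nat. 256 * 2 ^ L * (1 + L))"
  define a where "a = (\<lambda>L. \<omega> ((1 / real (N L)) ^ r))"
  have Npos: "0 < N L" for L by (simp add: N_def)
  have apos: "0 < a L" for L using Npos[of L] by (simp add: a_def abstract_modulus_pos[OF \<omega>])
  have N_top: "filterlim (\<lambda>L. real (N L)) at_top sequentially"
  proof (rule filterlim_at_top_mono[OF filterlim_real_sequentially])
    have "real L \<le> real (N L)" for L
    proof -
      have "1 * L \<le> (256 * 2 ^ L) * (1 + L)" by (intro mult_le_mono) auto
      then show ?thesis unfolding N_def by (simp only: of_nat_le_iff mult_1)
    qed
    then show "\<forall>\<^sub>F L in sequentially. real L \<le> real (N L)" by simp
  qed
  have step0: "filterlim (\<lambda>L. (1 / real (N L)) ^ r) (at_right 0) sequentially"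
  proof (rule tendsto_imp_filterlim_at_right)
    have "((\<lambda>L. (1 / real (N L)) ^ r) \<longlongrightarrow> 0 ^ r) sequentially"
      by (intro tendsto_power tendsto_divide_0[OF tendsto_const]
          filterlim_mono[OF N_top at_top_le_at_infinity order_refl])
    then show "((\<lambda>L. (1 / real (N L)) ^ r) \<longlongrightarrow> 0) sequentially" using assms(1) by (simp add: power_0_left)
    show "\<forall>\<^sub>F L in sequentially. 0 < (1 / real (N L)) ^ r" using Npos by simp
  qed
  have a0: "a \<longlonglongrightarrow> 0"
    unfolding a_def by (rule filterlim_compose[OF abstract_modulus_tendsto_0[OF \<omega>] step0])
  have aN: "filterlim (\<lambda>L. a L * real (N L) ^ r) at_top sequentially"
    using filterlim_compose[OF assms(3) step0] unfolding a_def by (simp add: power_one_over field_simps)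
  obtain \<phi> where \<phi>: "strict_mono \<phi>" "\<And>k. a (\<phi> (Suc k)) \<le> a (\<phi> k) / 4"
    "\<And>k. 2 * (a (\<phi> k) * real (N (\<phi> k)) ^ r) \<le> a (\<phi> (Suc k)) * real (N (\<phi> (Suc k))) ^ r"
    using exists_lacunary_subsequence[OF apos a0 aN] by blast
  define A where "A = (\<lambda>k. a (\<phi> k))"
  define M where "M = (\<lambda>k. real (N (\<phi> k)))"
  have Apos: "0 < A k" and Mpos: "0 < M k" for k using apos Npos by (simp_all add: A_def M_def)
  have A4: "A (Suc k) \<le> A k / 4" for k using \<phi>(2) by (simp add: A_def)
  have M_top: "filterlim M at_top sequentially"
    unfolding M_def by (rule filterlim_compose[OF N_top filterlim_subseq[OF \<phi>(1)]])

  let ?wave = "\<lambda>s. signed_wave s (Suc r) 1"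
  \<comment> \<open>The signs of the \<open>k\<close>-th hump depend on the sum \<open>F\<close> of all preceding humps.\<close>
  have "\<exists>s. (\<forall>i. \<bar>s i\<bar> \<le> 1) \<and> (\<forall>g\<in>networks (2 ^ \<phi> k) logistic. \<exists>x\<in>{0..1}.
           2 / 3 * A k < \<bar>F x + A k * ?wave s (M k * x) - g x\<bar>)" for k F
    using networks_miss_signed_wave[OF refl _ Apos, of "N (\<phi> k)" "\<phi> k" k F "Suc r"]
    by (simp add: N_def M_def)
  then obtain S where S: "\<And>k F i. \<bar>S k F i\<bar> \<le> 1"
    "\<And>k F g. g \<in> networks (2 ^ \<phi> k) logistic \<Longrightarrow>
       \<exists>x\<in>{0..1}. 2 / 3 * A k < \<bar>F x + A k * ?wave (S k F) (M k * x) - g x\<bar>"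
    by metis
  define F where "F = rec_nat (\<lambda>_. 0) (\<lambda>k F x. F x + A k * ?wave (S k F) (M k * x))"
  define w where "w = (\<lambda>k x. ?wave (S k (F k)) (M k * x))"
  define f where "f = (\<lambda>x. \<Sum>k. A k * w k x)"
  have F_Suc: "F (Suc k) x = F k x + A k * w k x" for k x by (simp add: F_def w_def)
  have F: "F k x = (\<Sum>i<k. A i * w i x)" for k x
    by (induction k) (simp add: F_def, simp add: F_Suc)
  have w1: "\<bar>w k x\<bar> \<le> 1" for k x
    using S(1) unfolding w_def signed_wave_def
    by (auto simp: abs_mult power_abs intro!: mult_le_one power_le_one)
  have "summable (\<lambda>k. A k * w k x)" for x
    using geometric_decay_tail(1)[where a = A and w = "\<lambda>k. w k x" and K = 0, OF less_imp_le[OF Apos] A4 w1] by simp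
  then have f: "(\<lambda>k. A k * w k x) sums f x" for x unfolding f_def by (rule summable_sums)

  have cont: "continuous_on {0..1} f"
  proof (rule uniform_limit_theorem[where F = sequentially])
    have "summable A"
      using geometric_decay_tail(1)[where a = A and w = "\<lambda>_. 1" and B = 1 and K = 0, OF less_imp_le[OF Apos] A4] by simp
    then show "uniform_limit {0..1} (\<lambda>n x. \<Sum>i<n. A i * w i x) f sequentially"
      unfolding f_def
      by (rule Weierstrass_m_test[rotated])
        (use Apos w1 in \<open>auto simp: abs_mult less_imp_le intro!: mult_left_le\<close>)
    obtain m where m: "r = Suc m" using assms(1) by (cases r) auto
    have "continuous_on UNIV (?wave (S k (F k)))" for k
      unfolding m using signed_wave_has_derivative[where s = "S k (F k)", OF S(1)]
      by (blast intro: DERIV_continuous_on)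
    then have "continuous_on {0..1} (w k)" for k
      unfolding w_def by (rule continuous_on_compose2) (auto intro!: continuous_intros)
    then show "\<forall>\<^sub>F n in sequentially. continuous_on {0..1} (\<lambda>x. \<Sum>i<n. A i * w i x)"
      by (intro always_eventually allI continuous_intros)
  qed simp

  obtain C where C: "0 \<le> C"
    "\<And>s h y. \<lbrakk>\<forall>i. \<bar>s i\<bar> \<le> 1; 0 < h\<rbrakk> \<Longrightarrow> \<bar>fwd_diff r h (?wave s) y\<bar> \<le> C * h ^ r"
    using fwd_diff_signed_wave[of r 1] by blast
  have wr: "\<bar>fwd_diff r h (w k) x\<bar> \<le> C * (M k * h) ^ r" if "0 < h" for k h x
    unfolding w_def fwd_diff_scale using C(2) S(1) Mpos that by simp
  have diff: "\<bar>fwd_diff r h f x\<bar> \<le> (4 * C + 4 / 3 * 2 ^ r) * \<omega> (h ^ r)" if "0 < h" "M 0 * h \<le> 1" for h x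
    by (rule fwd_diff_lacunary_series[where A = A and M = M and w = w])
      (use \<omega> Mpos M_top A4 \<phi>(3) w1 wr f C(1) that in \<open>auto simp: A_def a_def M_def\<close>)
  have "(\<lambda>\<delta>. smoothness_modulus r f \<delta>) \<in> O[at_right 0](\<lambda>\<delta>. \<omega> (\<delta> ^ r))"
  proof (rule bigoI)
    have "\<forall>\<^sub>F \<delta> in at_right 0. \<delta> \<in> {0<..<1 / M 0}"
      using Mpos[of 0] by (intro eventually_at_right_real) simp
    then show "\<forall>\<^sub>F \<delta> in at_right 0. norm (smoothness_modulus r f \<delta>)
        \<le> (4 * C + 4 / 3 * 2 ^ r) * norm (\<omega> (\<delta> ^ r))"
    proof eventually_elim
      case (elim \<delta>)
      have "\<bar>smoothness_modulus r f \<delta>\<bar> \<le> (4 * C + 4 / 3 * 2 ^ r) * \<omega> (\<delta> ^ r)"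
      proof (rule abs_smoothness_modulus_le)
        fix h x assume h: "0 < h" "h \<le> \<delta>"
        have "M 0 * h \<le> M 0 * \<delta>" using h Mpos[of 0] by (intro mult_left_mono) auto
        also have "\<dots> \<le> 1" using elim Mpos[of 0] by (simp add: field_simps)
        finally have "\<bar>fwd_diff r h f x\<bar> \<le> (4 * C + 4 / 3 * 2 ^ r) * \<omega> (h ^ r)"
          using h by (intro diff)
        also have "\<dots> \<le> (4 * C + 4 / 3 * 2 ^ r) * \<omega> (\<delta> ^ r)"
          using h C(1) by (intro mult_left_mono abstract_modulus_mono[OF \<omega>] power_mono) auto
        finally show "\<bar>fwd_diff r h f x\<bar> \<le> (4 * C + 4 / 3 * 2 ^ r) * \<omega> (\<delta> ^ r)" .
      qed (use elim in simp)
      then show ?case using abstract_modulus_pos[OF \<omega>, of "\<delta> ^ r"] elim by simp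
    qed
  qed

  moreover have lower: "A k / 3 \<le> best_approx_error (networks (2 ^ \<phi> k) logistic) f" for k
  proof (rule best_approx_error_ge[OF cont])
    fix g assume "g \<in> networks (2 ^ \<phi> k) logistic"
    then obtain x where x: "x \<in> {0..1}" "2 / 3 * A k < \<bar>F (Suc k) x - g x\<bar>"
      using S(2)[of g k "F k"] by (auto simp: F_Suc w_def)
    have "f x - F (Suc k) x = (\<Sum>i. A (i + Suc k) * w (i + Suc k) x)"
      unfolding F using suminf_minus_initial_segment[OF sums_summable[OF f[of x]], of "Suc k"]
      by (simp only: f_def)
    also have "\<bar>\<dots>\<bar> \<le> 4 / 3 * 1 * A (Suc k)"
      using Apos A4 w1 by (intro geometric_decay_tail) (auto intro: less_imp_le)
    also have "\<dots> \<le> A k / 3" using A4[of k] by simp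
    finally have "A k / 3 \<le> \<bar>f x - g x\<bar>" using x(2) by linarith
    then show "\<exists>x\<in>{0..1}. A k / 3 \<le> \<bar>f x - g x\<bar>" using x(1) by blast
  qed

  moreover have "(\<lambda>n. best_approx_error (networks n logistic) f)
             \<notin> o[at_top](\<lambda>n::nat. \<omega> (1 / (real n * (1 + log 2 (real n))) ^ r))"
  proof
    \<comment> \<open>Passing from \<open>1 / M ^ r\<close> to \<open>1 / (n * (1 + log\<^sub>2 n)) ^ r\<close> enlarges \<open>\<omega>\<close> by at most the
      factor \<open>256 ^ r\<close>; the \<open>4\<close> makes the upper bound \<open>A k / 4\<close> fall short of \<open>A k / 3\<close>.\<close>
    define c where "c = 1 / (4 * 256 ^ r :: real)"
    assume "(\<lambda>n. best_approx_error (networks n logistic) f)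
             \<in> o[at_top](\<lambda>n::nat. \<omega> (1 / (real n * (1 + log 2 (real n))) ^ r))"
    moreover have "0 < c" by (simp add: c_def)
    ultimately have "\<forall>\<^sub>F n in sequentially. norm (best_approx_error (networks n logistic) f)
        \<le> c * norm (\<omega> (1 / (real n * (1 + log 2 (real n))) ^ r))"
      by (rule landau_o.smallD)
    moreover have "filterlim (\<lambda>k. 2 ^ \<phi> k :: nat) at_top sequentially"
    proof (rule filterlim_subseq)
      show "strict_mono (\<lambda>k. 2 ^ \<phi> k :: nat)" using \<phi>(1) by (auto simp: strict_mono_def)
    qed
    ultimately have "\<forall>\<^sub>F k in sequentially. norm (best_approx_error (networks (2 ^ \<phi> k) logistic) f)
        \<le> c * norm (\<omega> (1 / (real (2 ^ \<phi> k) * (1 + log 2 (real (2 ^ \<phi> k)))) ^ r))"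
      by (rule eventually_compose_filterlim)
    then obtain k where k: "norm (best_approx_error (networks (2 ^ \<phi> k) logistic) f)
        \<le> c * norm (\<omega> (1 / (real (2 ^ \<phi> k) * (1 + log 2 (real (2 ^ \<phi> k)))) ^ r))"
      by (auto dest: eventually_happens)
    let ?n = "real (2 ^ \<phi> k) * (1 + log 2 (real (2 ^ \<phi> k)))"
    have "?n = M k / 256" by (simp add: M_def N_def log_nat_power algebra_simps)
    then have "1 / ?n ^ r = 1 / (M k / 256) ^ r" by (simp only:)
    then have n: "1 / ?n ^ r = 256 ^ r * (1 / M k) ^ r" by (simp add: power_divide)
    obtain m where m: "(256 ^ r :: nat) = Suc m" using not0_implies_Suc[of "256 ^ r"] by auto
    then have m': "(256 ^ r :: real) = real (Suc m)" by (metis of_nat_numeral of_nat_power)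
    have "\<omega> (1 / ?n ^ r) \<le> 256 ^ r * A k"
      unfolding n m' A_def a_def M_def using Npos by (intro abstract_modulus_nat_mult[OF \<omega>]) simp
    moreover have "0 < \<omega> (1 / ?n ^ r)"
      unfolding n using Mpos[of k] by (intro abstract_modulus_pos[OF \<omega>]) simp
    ultimately have "c * norm (\<omega> (1 / ?n ^ r)) \<le> A k / 4"
      by (simp add: c_def field_simps)
    with k lower[of k] have "A k / 3 \<le> A k / 4" by simp
    then show False using Apos[of k] by simp
  qed
  ultimately show ?thesis using cont by blast
qed

end
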